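(* For every $n\in\mathbb N$, $n\ge1$, the real Lie algebra $\mathfrak{sl}(2n+1,\mathbb C)_{\mathbb R}$ underlying $\mathfrak{sl}(2n+1,\mathbb C)$ admits a hypercomplex structure $\{J_1,J_2,J_3\}$ such that the inclusion $$\iota:\mathfrak{gl}(2n,\mathbb C)_{\mathbb R}\hookrightarrow\mathfrak{sl}(2n+1,\mathbb C)_{\mathbb R},\qquad X\mapsto\begin{bmatrix}X&0\\ 0&-\operatorname{tr}X\end{bmatrix},$$ is compatible with the hypercomplex structures on each Lie algebra, i.e. $\iota\circ J'_\alpha=J_\alpha\circ\iota$ for $\alpha=1,2,3$, where $\{J'_1,J'_2,J'_3\}$ is the natural hypercomplex structure on $\mathfrak{gl}(2n,\mathbb C)_{\mathbb R}$.
   Context: A hypercomplex structure on a real Lie algebra $\mathfrak g$ is a triple of linear maps with $J_\alpha^2=-\mathrm{Id}$, $J_1J_2=-J_2J_1=J_3$, and $[x,y]+J_\alpha([J_\alpha x,y]+[x,J_\alpha y])-[J_\alpha x,J_\alpha y]=0$ for all $x,y\in\mathfrak g$ and all $\alpha$. The natural hypercomplex structure on $\mathfrak{gl}(2n,\mathbb C)_{\mathbb R}$: let $J_0=\begin{bmatrix}0&-I_n\\ I_n&0\end{bmatrix}$, $E_0=\begin{bmatrix}I_n&0\\ 0&-I_n\end{bmatrix}$. Then $J_1'(X)=XJ_0$, $J_2'(X)=iXE_0$, $J_3'=J_1'J_2'$. (It is obtained from the real endomorphisms $J'X=XJ_0$, $E'X=XE_0$ of $\mathfrak{gl}(2n,\mathbb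 R)$ by letting $J'_1$ be the $\mathbb C$-linear extension of $J'$, and $J_2'$ be multiplication by $i$ on the complexified $(+1)$-eigenspace of $E'$ and by $-i$ on the complexified $(-1)$-eigenspace of $E'$.) *)

theory Defs
  imports "HOL-Analysis.Analysis"
begin

text \<open>Real Lie algebras are given by a carrier inside an ambient real vector space and a bracket
  that is only constrained on the carrier; likewise for the endomorphisms below.\<close>

locale real_lie_algebra =
  fixes \<gg> :: "'a::real_vector set"
    and br :: "'a \<Rightarrow> 'a \<Rightarrow> 'a"
  assumes subspace_carrier: "subspace \<gg>"
    and br_closed: "\<lbrakk>x \<in> \<gg>; y \<in> \<gg>\<rbrakk> \<Longrightarrow> br x y \<in> \<gg>"
    and br_add_left: "\<lbrakk>x \<in> \<gg>; y \<in> \<gg>; z \<in> \<gg>\<rbrakk> \<Longrightarrow> br (x + y) z = br x z + br y z"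
    and br_scaleR_left: "\<lbrakk>x \<in> \<gg>; y \<in> \<gg>\<rbrakk> \<Longrightarrow> br (c *\<^sub>R x) y = c *\<^sub>R br x y"
    and br_add_right: "\<lbrakk>x \<in> \<gg>; y \<in> \<gg>; z \<in> \<gg>\<rbrakk> \<Longrightarrow> br x (y + z) = br x y + br x z"
    and br_scaleR_right: "\<lbrakk>x \<in> \<gg>; y \<in> \<gg>\<rbrakk> \<Longrightarrow> br x (c *\<^sub>R y) = c *\<^sub>R br x y"
    and br_self: "x \<in> \<gg> \<Longrightarrow> br x x = 0"
    and jacobi: "\<lbrakk>x \<in> \<gg>; y \<in> \<gg>; z \<in> \<gg>\<rbrakk> \<Longrightarrow>
      br x (br y z) + br y (br z x) + br z (br x y) = 0"

locale hypercomplex_structure = real_lie_algebra \<gg> br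
  for \<gg> :: "'a::real_vector set" and br :: "'a \<Rightarrow> 'a \<Rightarrow> 'a" +
  fixes J1 J2 J3 :: "'a \<Rightarrow> 'a"
  assumes J_closed: "\<lbrakk>J \<in> {J1, J2, J3}; x \<in> \<gg>\<rbrakk> \<Longrightarrow> J x \<in> \<gg>"
    and J_add: "\<lbrakk>J \<in> {J1, J2, J3}; x \<in> \<gg>; y \<in> \<gg>\<rbrakk> \<Longrightarrow> J (x + y) = J x + J y"
    and J_scaleR: "\<lbrakk>J \<in> {J1, J2, J3}; x \<in> \<gg>\<rbrakk> \<Longrightarrow> J (c *\<^sub>R x) = c *\<^sub>R J x"
    and J_square: "\<lbrakk>J \<in> {J1, J2, J3}; x \<in> \<gg>\<rbrakk> \<Longrightarrow> J (J x) = - x"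
    and J12: "x \<in> \<gg> \<Longrightarrow> J1 (J2 x) = J3 x"
    and J21: "x \<in> \<gg> \<Longrightarrow> - J2 (J1 x) = J3 x"
    and integrable: "\<lbrakk>J \<in> {J1, J2, J3}; x \<in> \<gg>; y \<in> \<gg>\<rbrakk> \<Longrightarrow>
      br x y + J (br (J x) y + br x (J y)) - br (J x) (J y) = 0"

definition commutator :: "complex^'m^'m \<Rightarrow> complex^'m^'m \<Rightarrow> complex^'m^'m" where
  "commutator A B = A ** B - B ** A"

text \<open>The underlying real vector space structure of complex matrices is the one of the
  type class instance, i.e. entrywise multiplication by real scalars.\<close>

definition gl_carrier :: "(complex^'m^'m) set" where
  "gl_carrier = UNIV"

definition sl_carrier :: "(complex^'m^'m) set" where
  "sl_carrier = {A. trace A = 0}"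

text \<open>Block matrices are indexed by sum types. With \<open>CARD('n) = n\<close>, the index type
  \<open>'n + 'n\<close> has \<open>2n\<close> elements and \<open>('n + 'n) + 1\<close> has \<open>2n + 1\<close> elements
  (\<open>1\<close> is the one-element type of \<open>Numeral_Type\<close>).\<close>

definition block_mat ::
  "'a^'p^'m \<Rightarrow> 'a^'q^'m \<Rightarrow> 'a^'p^'k \<Rightarrow> 'a^'q^'k \<Rightarrow> 'a^('p + 'q)^('m + 'k)" where
  "block_mat A B C D = (\<chi> i j.
     case i of
       Inl a \<Rightarrow> (case j of Inl b \<Rightarrow> A $ a $ b | Inr b \<Rightarrow> B $ a $ b)
     | Inr a \<Rightarrow> (case j of Inl b \<Rightarrow> C $ a $ b | Inr b \<Rightarrow> D $ a $ b))"

definition J0 :: "complex^('n::finite + 'n)^('n + 'n)" where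
  "J0 = block_mat 0 (- mat 1) (mat 1) 0"

definition E0 :: "complex^('n::finite + 'n)^('n + 'n)" where
  "E0 = block_mat (mat 1) 0 0 (- mat 1)"

definition gl_J1 :: "complex^('n::finite + 'n)^('n + 'n) \<Rightarrow> complex^('n + 'n)^('n + 'n)" where
  "gl_J1 X = X ** J0"

definition gl_J2 :: "complex^('n::finite + 'n)^('n + 'n) \<Rightarrow> complex^('n + 'n)^('n + 'n)" where
  "gl_J2 X = (\<chi> i j. \<i> * (X ** E0) $ i $ j)"

definition gl_J3 :: "complex^('n::finite + 'n)^('n + 'n) \<Rightarrow> complex^('n + 'n)^('n + 'n)" where
  "gl_J3 = gl_J1 \<circ> gl_J2"

definition gl_to_sl ::
  "complex^('n::finite + 'n)^('n + 'n) \<Rightarrow> complex^(('n + 'n) + 1)^(('n + 'n) + 1)" where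
  "gl_to_sl X = block_mat X 0 0 (mat (- trace X))"

text \<open>Well-definedness: \<open>gl_J1\<close>, \<open>gl_J2\<close>, \<open>gl_J3\<close> form a hypercomplex structure, and
  \<open>gl_to_sl\<close> is an injective real Lie algebra homomorphism into the traceless matrices.\<close>

lemma sum_UNIV_Plus:
  "(\<Sum>i\<in>(UNIV :: ('p::finite + 'q::finite) set). f i) =
    (\<Sum>i\<in>UNIV. f (Inl i)) + (\<Sum>i\<in>UNIV. f (Inr i))"
  using sum.Plus[of "UNIV :: 'p set" "UNIV :: 'q set" f] by (simp add: comp_def)

lemma block_mat_nth [simp]:
  "block_mat A B C D $ Inl a $ Inl b = A $ a $ b"
  "block_mat A B C D $ Inl a $ Inr b' = B $ a $ b'"
  "block_mat A B C D $ Inr a' $ Inl b = C $ a' $ b"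
  "block_mat A B C D $ Inr a' $ Inr b' = D $ a' $ b'"
  by (simp_all add: block_mat_def)

lemma block_mat_eqI:
  assumes "\<And>a b. M $ Inl a $ Inl b = N $ Inl a $ Inl b"
    and "\<And>a b. M $ Inl a $ Inr b = N $ Inl a $ Inr b"
    and "\<And>a b. M $ Inr a $ Inl b = N $ Inr a $ Inl b"
    and "\<And>a b. M $ Inr a $ Inr b = N $ Inr a $ Inr b"
  shows "M = N"
  unfolding vec_eq_iff using assms by (metis sum.exhaust)

lemma block_mat_mult:
  fixes A :: "'a::semiring_1^'p::finite^'m::finite" and B :: "'a^'q::finite^'m"
    and C :: "'a^'p^'k::finite" and D :: "'a^'q^'k"
    and A' :: "'a^'r::finite^'p" and B' :: "'a^'s::finite^'p"
    and C' :: "'a^'r^'q" and D' :: "'a^'s^'q"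
  shows "block_mat A B C D ** block_mat A' B' C' D' =
    block_mat (A ** A' + B ** C') (A ** B' + B ** D') (C ** A' + D ** C') (C ** B' + D ** D')"
  by (rule block_mat_eqI) (simp_all add: matrix_matrix_mult_def sum_UNIV_Plus)

lemma matrix_mult_simps:
  fixes A B C :: "complex^'m::finite^'m"
  shows "A ** (B + C) = A ** B + A ** C" "(A + B) ** C = A ** C + B ** C"
    "A ** (B - C) = A ** B - A ** C" "(A - B) ** C = A ** C - B ** C"
    "A ** (- B) = - (A ** B)" "(- A) ** B = - (A ** B)"
    "A ** (c *\<^sub>R B) = c *\<^sub>R (A ** B)" "(c *\<^sub>R A) ** B = c *\<^sub>R (A ** B)"
  by (simp_all add: vec_eq_iff matrix_matrix_mult_def algebra_simps sum.distrib sum_subtractf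
        sum_negf scaleR_sum_right)

lemma gl_real_lie_algebra: "real_lie_algebra (gl_carrier :: (complex^'m::finite^'m) set) commutator"
  by unfold_locales
    (simp_all add: gl_carrier_def commutator_def matrix_mult_simps matrix_mul_assoc algebra_simps subspace_def)

lemma gl_J_relations:
  "J0 ** J0 = - mat 1" "E0 ** E0 = mat 1" "E0 ** J0 = - (J0 ** E0)"
  unfolding J0_def E0_def block_mat_mult
  by (rule block_mat_eqI; simp add: matrix_matrix_mult_def mat_def if_distrib[of "\<lambda>x. x * _"]
        sum_negf cong: if_cong)+

lemma mat_mult_left:
  "mat c ** (A :: complex^'m::finite^'m) = (\<chi> i j. c * A $ i $ j)"
  by (simp add: vec_eq_iff matrix_matrix_mult_def mat_def if_distrib[of "\<lambda>x. x * _"] cong: if_cong)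

lemma gl_J2_alt: "gl_J2 X = mat \<i> ** (X ** E0)"
  by (simp add: gl_J2_def mat_mult_left)

lemma mat_central: "A ** mat c = mat c ** (A :: complex^'m::finite^'m)"
  by (simp add: vec_eq_iff matrix_matrix_mult_def mat_def if_distrib[of "\<lambda>x. x * _"]
      if_distrib[of "\<lambda>x. _ * x"] mult.commute cong: if_cong)

lemma gl_hypercomplex_structure:
  "hypercomplex_structure (gl_carrier :: (complex^('n::finite + 'n)^('n + 'n)) set) commutator
     gl_J1 gl_J2 gl_J3"
proof -
  interpret real_lie_algebra "gl_carrier :: (complex^('n::finite + 'n)^('n + 'n)) set" commutator
    by (rule gl_real_lie_algebra)
  txt \<open>All three endomorphisms are right multiplications by square roots of \<open>- mat 1\<close>.\<close>
  define right where "right Q X = X ** Q" for Q X :: "complex^('n + 'n)^('n + 'n)"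
  have ii: "mat \<i> ** mat \<i> = - (mat 1 :: complex^('n + 'n)^('n + 'n))"
    by (simp add: vec_eq_iff matrix_matrix_mult_def mat_def if_distrib[of "\<lambda>x. x * _"] cong: if_cong)
  define Q2 :: "complex^('n + 'n)^('n + 'n)" where "Q2 = mat \<i> ** E0"
  define Q3 :: "complex^('n + 'n)^('n + 'n)" where "Q3 = Q2 ** J0"
  have sq1: "J0 ** J0 = - (mat 1 :: complex^('n + 'n)^('n + 'n))"
    by (rule gl_J_relations)
  have "Q2 ** Q2 = mat \<i> ** (E0 ** mat \<i>) ** E0"
    by (simp add: Q2_def matrix_mul_assoc)
  also have "\<dots> = mat \<i> ** mat \<i> ** (E0 ** E0)"
    by (simp only: mat_central[of E0] matrix_mul_assoc)
  also have "\<dots> = - mat 1" by (simp add: gl_J_relations ii)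
  finally have sq2: "Q2 ** Q2 = - mat 1" .
  have anti: "J0 ** Q2 = - Q3"
  proof -
    have "J0 ** Q2 = mat \<i> ** (J0 ** E0)"
      by (simp only: Q2_def matrix_mul_assoc mat_central[of J0])
    also have "J0 ** E0 = - (E0 ** J0 :: complex^('n + 'n)^('n + 'n))"
      by (simp add: gl_J_relations)
    finally show ?thesis by (simp add: Q3_def Q2_def matrix_mult_simps matrix_mul_assoc)
  qed
  have "Q3 ** Q3 = Q2 ** (J0 ** Q2) ** J0"
    by (simp add: Q3_def matrix_mul_assoc)
  also have "\<dots> = - (Q2 ** Q2 ** (J0 ** J0))"
    by (simp only: anti Q3_def matrix_mult_simps matrix_mul_assoc)
  also have "\<dots> = - mat 1" by (simp add: sq1 sq2 matrix_mult_simps)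
  finally have sq3: "Q3 ** Q3 = - mat 1" .
  have J1: "gl_J1 = right J0" by (simp add: fun_eq_iff gl_J1_def right_def)
  have J2: "gl_J2 = right Q2"
    unfolding fun_eq_iff gl_J2_alt right_def Q2_def by (metis mat_central matrix_mul_assoc)
  have J3: "gl_J3 = right Q3"
    by (simp add: fun_eq_iff gl_J3_def J1 J2 right_def Q3_def matrix_mul_assoc)
  have ex: "\<exists>Q. J = right Q \<and> Q ** Q = - mat 1" if "J \<in> {gl_J1, gl_J2, gl_J3}" for J
    using that J1 J2 J3 sq1 sq2 sq3 by blast
  show ?thesis
  proof unfold_locales
    fix J :: "complex^('n + 'n)^('n + 'n) \<Rightarrow> complex^('n + 'n)^('n + 'n)"
      and x y :: "complex^('n + 'n)^('n + 'n)" and c :: real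
    show "gl_J1 (gl_J2 x) = gl_J3 x" by (simp add: gl_J3_def)
    show "- gl_J2 (gl_J1 x) = gl_J3 x"
      by (simp add: J1 J2 J3 right_def matrix_mul_assoc[symmetric] anti matrix_mult_simps(5))
    show "J x \<in> gl_carrier" by (simp add: gl_carrier_def)
    assume "J \<in> {gl_J1, gl_J2, gl_J3}"
    then obtain Q where J: "J = right Q" and Q: "Q ** Q = - mat 1" using ex by blast
    show "J (x + y) = J x + J y" "J (c *\<^sub>R x) = c *\<^sub>R J x"
      by (simp_all add: J right_def matrix_mult_simps)
    have QQ: "z ** Q ** Q = - z" for z :: "complex^('n + 'n)^('n + 'n)"
      by (simp add: matrix_mul_assoc[symmetric] Q matrix_mult_simps(5))
    show "J (J x) = - x" by (simp add: J right_def QQ)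
    show "commutator x y + J (commutator (J x) y + commutator x (J y)) - commutator (J x) (J y) = 0"
      by (simp add: J right_def commutator_def matrix_mult_simps matrix_mul_assoc QQ)
  qed
qed

lemma trace_simps:
  fixes A B :: "complex^'m::finite^'m"
  shows "trace (A + B) = trace A + trace B" "trace (c *\<^sub>R A) = c *\<^sub>R trace A"
    "trace (commutator A B) = 0" "trace (0 :: complex^'m^'m) = 0"
  by (simp_all add: commutator_def trace_add trace_sub trace_mul_sym[of A B])
     (simp_all add: trace_def scaleR_sum_right)

lemma sl_real_lie_algebra: "real_lie_algebra (sl_carrier :: (complex^'m::finite^'m) set) commutator"
proof -
  interpret real_lie_algebra "gl_carrier :: (complex^'m::finite^'m) set" commutator
    by (rule gl_real_lie_algebra)
  show ?thesis
    by unfold_locales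
      (simp_all add: sl_carrier_def subspace_def trace_simps gl_carrier_def br_add_left
        br_add_right br_scaleR_left br_scaleR_right br_self jacobi)
qed

lemma gl_to_sl_hom:
  fixes X Y :: "complex^('n::finite + 'n)^('n + 'n)"
  shows "gl_to_sl X \<in> sl_carrier"
    and "gl_to_sl (X + Y) = gl_to_sl X + gl_to_sl Y"
    and "gl_to_sl (c *\<^sub>R X) = c *\<^sub>R gl_to_sl X"
    and "gl_to_sl (commutator X Y) = commutator (gl_to_sl X) (gl_to_sl Y)"
    and "inj (gl_to_sl :: complex^('n + 'n)^('n + 'n) \<Rightarrow> _)"
proof -
  show "gl_to_sl X \<in> sl_carrier"
    by (simp add: sl_carrier_def gl_to_sl_def trace_def sum_UNIV_Plus[where 'q=1] mat_def)
  show "gl_to_sl (X + Y) = gl_to_sl X + gl_to_sl Y"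
    and "gl_to_sl (c *\<^sub>R X) = c *\<^sub>R gl_to_sl X"
    by (rule block_mat_eqI; simp add: gl_to_sl_def trace_simps mat_def)+
  show "gl_to_sl (commutator X Y) = commutator (gl_to_sl X) (gl_to_sl Y)"
    unfolding gl_to_sl_def commutator_def[of "block_mat _ _ _ _"] block_mat_mult trace_simps
    by (rule block_mat_eqI) (simp_all add: commutator_def mat_def matrix_matrix_mult_def)
  show "inj (gl_to_sl :: complex^('n + 'n)^('n + 'n) \<Rightarrow> _)"
    by (rule injI) (metis gl_to_sl_def block_mat_nth(1) vec_eq_iff)
qed

end

(* Identify sl(2n+1,C) with the matrices [X v; w -tr X], X of size 2n. For every Q with Q^2 = -1 the
   complex linear map  [X v; w -tr X] |-> [XQ -Qv; wQ -tr(XQ)]  is an integrable complex structure: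
   with L the kernel of Q + i, its i-eigenspace consists of the matrices with X = 0 and w = 0 on L
   and v in L, and this is a subalgebra; the same holds for -i. On gl(2n,C) the map is right
   multiplication by Q, so the natural hypercomplex structure extends by taking Q = J0, i E0, i E0 J0.
   If P and Q anticommute, the map of P after the map of Q is the map of QP: on v this reads
   PQv = -(QP)v. *)

theory Submission
  imports Defs
begin

section \<open>Rectangular complex matrices\<close>

lemma matrix_mult_rect_simps:
  fixes A A' :: "complex^'m::finite^'k::finite" and B B' :: "complex^'p::finite^'m"
  shows "A ** (B + B') = A ** B + A ** B'" "(A + A') ** B = A ** B + A' ** B"
    "A ** (B - B') = A ** B - A ** B'" "(A - A') ** B = A ** B - A' ** B"
    "A ** (- B) = - (A ** B)" "(- A) ** B = - (A ** B)"
    "A ** (c *\<^sub>R B) = c *\<^sub>R (A ** B)" "(c *\<^sub>R A) ** B = c *\<^sub>R (A ** B)"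
  by (simp_all add: vec_eq_iff matrix_matrix_mult_def algebra_simps sum.distrib sum_subtractf
        sum_negf scaleR_sum_right)

lemma matrix_mult_zero_simps [simp]:
  fixes A :: "complex^'m::finite^'k::finite"
  shows "A ** (0 :: complex^'p::finite^'m) = 0" "(0 :: complex^'k^'p) ** A = 0"
  by (simp_all add: vec_eq_iff matrix_matrix_mult_def)

text \<open>The two occurrences of \<open>mat c\<close> may differ in size: scalars must also pass
  through row and column blocks.\<close>

lemma matrix_mult_mat_right:
  fixes A :: "complex^'m::finite^'k::finite"
  shows "A ** mat c = mat c ** A"
  by (simp add: vec_eq_iff matrix_matrix_mult_def mat_def if_distrib[of "\<lambda>x. x * _"]
      if_distrib[of "\<lambda>x. _ * x"] mult.commute cong: if_cong)

lemma mat_arith: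
  "mat (a + b) = (mat a + mat b :: complex^'m::finite^'m)"
  "mat (a - b) = (mat a - mat b :: complex^'m::finite^'m)"
  "mat (- a) = (- mat a :: complex^'m::finite^'m)"
  by (simp_all add: vec_eq_iff mat_def)

lemma mat_mult_mat: "mat a ** mat b = (mat (a * b) :: complex^'m::finite^'m)"
  by (simp add: mat_mult_left) (simp add: vec_eq_iff mat_def)

lemma trace_minus: "trace (- A) = - trace (A :: complex^'m::finite^'m)"
  by (simp add: trace_def sum_negf)

lemma trace_mult_commute_rect:
  fixes A :: "complex^'m::finite^'k::finite" and B :: "complex^'k^'m"
  shows "trace (A ** B) = trace (B ** A)"
  unfolding trace_def matrix_matrix_mult_def
  by (simp add: mult.commute) (rule sum.swap)

lemma mat_trace_one_dim: "mat (trace A) = (A :: complex^1^1)"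
  by (simp add: vec_eq_iff mat_def trace_def)

section \<open>Block coordinates on traceless matrices\<close>

text \<open>Tracelessness forces the corner entry, so \<open>X\<close>, \<open>v\<close>,
  \<open>w\<close> are free coordinates on \<open>sl_carrier\<close>.\<close>

definition sl_block ::
  "complex^'m^'m \<Rightarrow> complex^1^'m \<Rightarrow> complex^'m^1 \<Rightarrow> complex^('m::finite + 1)^('m + 1)" where
  "sl_block X v w = block_mat X v w (mat (- trace X))"

lemma sl_block_arith:
  "sl_block X v w + sl_block Y u z = sl_block (X + Y) (v + u) (w + z)"
  "c *\<^sub>R sl_block X v w = sl_block (c *\<^sub>R X) (c *\<^sub>R v) (c *\<^sub>R w)"
  "- sl_block X v w = sl_block (- X) (- v) (- w)"
  "sl_block X v w - sl_block Y u z = sl_block (X - Y) (v - u) (w - z)"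
  "sl_block 0 0 0 = 0"
  by (rule block_mat_eqI; simp add: sl_block_def trace_simps trace_minus trace_sub mat_def)+

lemma sl_block_in_sl_carrier: "sl_block X v w \<in> sl_carrier"
  by (simp add: sl_carrier_def sl_block_def trace_def sum_UNIV_Plus[where 'q=1] mat_def)

lemma sl_carrierE:
  fixes M :: "complex^('m::finite + 1)^('m + 1)"
  assumes "M \<in> sl_carrier"
  obtains X v w where "M = sl_block X v w"
proof
  let ?X = "\<chi> i j. M $ Inl i $ Inl j"
  have "M $ Inr 1 $ Inr 1 = - trace ?X"
    using assms
    by (simp add: sl_carrier_def trace_def sum_UNIV_Plus[where 'q=1] add.commute eq_neg_iff_add_eq_0)
  then have "M $ Inr a $ Inr b = - trace ?X" for a b :: 1
    by (metis (full_types) num1_eq1)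
  then show "M = sl_block ?X (\<chi> i j. M $ Inl i $ Inr j) (\<chi> i j. M $ Inr i $ Inl j)"
    unfolding sl_block_def by (intro block_mat_eqI) (simp_all add: mat_def num1_eq_iff)
qed

lemma commutator_sl_block:
  "commutator (sl_block X v w) (sl_block Y u z) =
     sl_block (X ** Y - Y ** X + v ** z - u ** w)
       (X ** u + mat (trace X) ** u - Y ** v - mat (trace Y) ** v)
       (w ** Y + mat (trace Y) ** w - z ** X - mat (trace X) ** z)"
proof -
  \<comment> \<open>The corner of the commutator is the 1x1 matrix \<open>w ** u - z ** v\<close>;
    cyclicity of the trace identifies it with minus the trace of the upper left block.\<close>
  have "mat (trace (v ** z)) = z ** v" "mat (trace (u ** w)) = w ** u"
    by (simp_all only: trace_mult_commute_rect[of v z] trace_mult_commute_rect[of u w]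
        mat_trace_one_dim)
  then have "mat (- trace (X ** Y - Y ** X + v ** z - u ** w)) = w ** u - z ** v"
    by (simp add: trace_add trace_sub trace_mul_sym[of X Y] mat_arith)
  then show ?thesis
    unfolding sl_block_def commutator_def block_mat_mult
    by (intro block_mat_eqI)
      (simp_all add: mat_arith matrix_mult_rect_simps matrix_mult_mat_right[of v]
        matrix_mult_mat_right[of u] mat_mult_mat mult.commute)
qed

section \<open>The complex structures\<close>

text \<open>The sign makes eigenvectors pair to zero: if XQ = aX and -Qv = av with a nonzero, then
  XQv equals both aXv and -aXv, so Xv = 0; likewise wv = 0.\<close>

definition sl_J ::
  "complex^'m^'m \<Rightarrow> complex^('m::finite + 1)^('m + 1) \<Rightarrow> complex^('m + 1)^('m + 1)" where
  "sl_J Q M = sl_block ((\<chi> i j. M $ Inl i $ Inl j) ** Q)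
     (- (Q ** (\<chi> i j. M $ Inl i $ Inr j))) ((\<chi> i j. M $ Inr i $ Inl j) ** Q)"

lemma sl_J_sl_block: "sl_J Q (sl_block X v w) = sl_block (X ** Q) (- (Q ** v)) (w ** Q)"
  by (simp add: sl_J_def) (simp add: sl_block_def)

lemma sl_J_integrable:
  assumes Q: "Q ** Q = - mat 1" and "x \<in> sl_carrier" "y \<in> sl_carrier"
  shows "commutator x y + sl_J Q (commutator (sl_J Q x) y + commutator x (sl_J Q y))
    - commutator (sl_J Q x) (sl_J Q y) = 0"
proof -
  have Qr: "A ** Q ** Q = - A" for A :: "complex^'a^'k::finite"
    by (simp add: matrix_mul_assoc[symmetric] Q matrix_mult_rect_simps(5))
  have Ql: "Q ** Q ** B = - B" for B :: "complex^'k::finite^'a"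
    by (simp add: Q matrix_mult_rect_simps(6))
  obtain X v w where x: "x = sl_block X v w" using assms(2) by (rule sl_carrierE)
  obtain Y u z where y: "y = sl_block Y u z" using assms(3) by (rule sl_carrierE)
  show ?thesis
    \<comment> \<open>In the column block of the two mixed brackets the terms XQu and YQv cancel
      thanks to the sign in \<open>sl_J\<close>; everything left cancels in pairs once
      \<open>Qr\<close> and \<open>Ql\<close> collapse QQ.\<close>
    unfolding x y sl_J_sl_block commutator_sl_block sl_block_arith
    by (simp add: matrix_mult_rect_simps matrix_mul_assoc matrix_mult_mat_right[of Q] Qr Ql
        sl_block_arith)
qed

lemma sl_hypercomplex_structure:
  fixes P Q :: "complex^'m::finite^'m"
  assumes P: "P ** P = - mat 1" and Q: "Q ** Q = - mat 1" and anti: "P ** Q = - (Q ** P)"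
  shows "hypercomplex_structure sl_carrier commutator (sl_J P) (sl_J Q) (sl_J (Q ** P))"
proof -
  interpret real_lie_algebra "sl_carrier :: (complex^('m + 1)^('m + 1)) set" commutator
    by (rule sl_real_lie_algebra)
  have "Q ** P ** (Q ** P) = Q ** (P ** Q) ** P" by (simp add: matrix_mul_assoc)
  also have "\<dots> = - (Q ** Q ** (P ** P))"
    by (simp only: anti matrix_mult_simps matrix_mul_assoc)
  finally have QP: "Q ** P ** (Q ** P) = - mat 1" by (simp add: P Q matrix_mult_simps)
  have ex: "\<exists>R. J = sl_J R \<and> R ** R = - mat 1" if "J \<in> {sl_J P, sl_J Q, sl_J (Q ** P)}" for J
    using that P Q QP by blast
  show ?thesis
  proof unfold_locales
    fix J :: "complex^('m + 1)^('m + 1) \<Rightarrow> complex^('m + 1)^('m + 1)"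
      and x y :: "complex^('m + 1)^('m + 1)" and c :: real
    assume xs: "x \<in> sl_carrier"
    then obtain X v w where x: "x = sl_block X v w" by (rule sl_carrierE)
    show "sl_J P (sl_J Q x) = sl_J (Q ** P) x"
      using anti by (simp add: x sl_J_sl_block matrix_mult_rect_simps matrix_mul_assoc)
    \<comment> \<open>In this order the column block agrees at once, and \<open>X\<close> and
      \<open>w\<close> need the anticommutation.\<close>
    show "- sl_J Q (sl_J P x) = sl_J (Q ** P) x"
      by (simp add: x sl_J_sl_block sl_block_arith matrix_mult_rect_simps
          matrix_mul_assoc[symmetric] anti)
    assume "J \<in> {sl_J P, sl_J Q, sl_J (Q ** P)}"
    then obtain R where J: "J = sl_J R" and R: "R ** R = - mat 1" using ex by blast
    show "J x \<in> sl_carrier" by (simp add: J x sl_J_sl_block sl_block_in_sl_carrier)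
    show "J (c *\<^sub>R x) = c *\<^sub>R J x"
      by (simp add: J x sl_J_sl_block sl_block_arith matrix_mult_rect_simps)
    \<comment> \<open>Two passes: \<open>X\<close> and \<open>w\<close> need RR grouped on the
      right, the column block needs it grouped on the left.\<close>
    show "J (J x) = - x"
      by (simp add: J x sl_J_sl_block sl_block_arith matrix_mult_rect_simps
          matrix_mul_assoc[symmetric] R)
        (simp add: matrix_mul_assoc R matrix_mult_rect_simps)
    assume ys: "y \<in> sl_carrier"
    then obtain Y u z where y: "y = sl_block Y u z" by (rule sl_carrierE)
    show "J (x + y) = J x + J y"
      by (simp add: J x y sl_J_sl_block sl_block_arith matrix_mult_rect_simps)
    show "commutator x y + J (commutator (J x) y + commutator x (J y)) - commutator (J x) (J y) = 0"
      unfolding J using R xs ys by (rule sl_J_integrable)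
  qed
qed

text \<open>Zero blocks \<open>v\<close> and \<open>w\<close> stay zero under \<open>sl_J\<close>,
  so compatibility only requires the natural structure to act by right multiplications.\<close>

lemma gl_to_sl_mult_right:
  fixes X Q :: "complex^('n::finite + 'n)^('n + 'n)"
  shows "gl_to_sl (X ** Q) = sl_J Q (gl_to_sl X)"
proof -
  have "gl_to_sl Y = sl_block Y 0 0" for Y :: "complex^('n + 'n)^('n + 'n)"
    by (simp add: gl_to_sl_def sl_block_def)
  then show ?thesis by (simp add: sl_J_sl_block)
qed

theorem corollary4p3:
  "\<exists>J1 J2 J3 :: complex^(('n::finite + 'n) + 1)^(('n + 'n) + 1) \<Rightarrow> complex^(('n + 'n) + 1)^(('n + 'n) + 1).
     hypercomplex_structure sl_carrier commutator J1 J2 J3 \<and>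
     gl_to_sl \<circ> gl_J1 = J1 \<circ> gl_to_sl \<and>
     gl_to_sl \<circ> gl_J2 = J2 \<circ> gl_to_sl \<and>
     gl_to_sl \<circ> gl_J3 = J3 \<circ> gl_to_sl"
proof -
  \<comment> \<open>Absorbing the scalar i into the matrix turns \<open>gl_J2\<close> into a right
    multiplication.\<close>
  define Q :: "complex^('n + 'n)^('n + 'n)" where "Q = E0 ** mat \<i>"
  have "Q ** Q = E0 ** (mat \<i> ** E0) ** mat \<i>"
    by (simp add: Q_def matrix_mul_assoc)
  also have "\<dots> = E0 ** E0 ** (mat \<i> ** mat \<i>)"
    by (simp only: mat_central[of E0, symmetric] matrix_mul_assoc)
  finally have Q: "Q ** Q = - mat 1"
    by (simp add: gl_J_relations mat_mult_mat mat_arith)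
  have "Q ** J0 = E0 ** J0 ** mat \<i>"
    by (simp only: Q_def matrix_mul_assoc[symmetric] mat_central[of J0])
  then have anti: "J0 ** Q = - (Q ** J0)"
    by (simp add: gl_J_relations Q_def matrix_mult_simps matrix_mul_assoc)
  have J1: "gl_J1 X = X ** J0" for X :: "complex^('n + 'n)^('n + 'n)"
    by (rule gl_J1_def)
  have J2: "gl_J2 X = X ** Q" for X :: "complex^('n + 'n)^('n + 'n)"
    by (simp add: gl_J2_alt Q_def mat_central matrix_mul_assoc)
  \<comment> \<open>Right multiplications compose in reverse order, which matches the third map
    \<open>sl_J (Q ** P)\<close> for P = \<open>J0\<close>.\<close>
  have J3: "gl_J3 X = X ** (Q ** J0)" for X :: "complex^('n + 'n)^('n + 'n)"
    by (simp add: gl_J3_def J1 J2 matrix_mul_assoc)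
  show ?thesis
    by (intro exI conjI, rule sl_hypercomplex_structure[OF gl_J_relations(1) Q anti])
      (simp_all add: fun_eq_iff J1 J2 J3 gl_to_sl_mult_right)
qed

end
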